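(* Let $G$ be a Garside group, the group of fractions of a Garside monoid $M$ with Garside element $\delta$. Let $x\in G$, $y\in U_x$ and $z\in T_y$. For any $s\in C_z$ there exists $t\in C_y$ such that $z^s\in T_{y^t}$.
   Context: **Garside monoids and groups.** Let $M$ be a (left and right) cancellative monoid. For $a,b\in M$ write $a\preceq b$ if $ac=b$ for some $c\in M$, and $a\succeq b$ if $a=cb$ for some $c\in M$. The (left) gcd $a\wedge b$ and (left) lcm $a\vee b$ are the greatest lower bound and least upper bound with respect to $\preceq$. An atom is an element $x\neq 1$ such that $x=ab$ with $a,b\in M$ implies $a=1$ or $b=1$. $M$ is atomic if it is generated by its atoms and for every $a\in M$ there is a bound $N_a$ such that $a$ is not a product of more than $N_a$ atoms. An element $\delta\in M$ is a Garside element if $\{x\in M: x\preceq\delta\}=\{x\in M:\delta\succeq x\}$ and this set is finite and generates $M$. $M$ is a Garside monoid if it is atomic, has a Garside element $\delta$, and gcd and lcm of any $a,b\in M$ exist (they are then unique). Its group of fractions $G$ is called a Garside group; $M$ embeds in $G$ and is identified with its image. The set of simple elements is $D=\{x\in M: x\preceq\delta\}$. Extend $\preceq$ to $G$ by: $a\preceq b$ iff $a^{-1}b\in M$; the notions $\wedge,\vee$ extend to $G$. Conjugation is $x^c=c^{-1}xc$, and $\tau(x)=x^\delta=\delta^{-1}x\delta$; $\tau$ preserves $M$ and $\preceq$. **Normal form.** For $x\in G$ let $\inf(x)$ be the maximal integer $k$ with $\delta^k\preceq x$, $\sup(x)$ the minimal integer $m$ with $x\preceq\delta^m$, and $\mathrm{len}(x)=\sup(x)-\inf(x)\ge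 0$. With $k=\inf(x)$, $r=\mathrm{len}(x)$, there are unique $A_1,\dots,A_r\in D$ with $x=\delta^kA_1\cdots A_r$ and $A_i^{-1}\delta\wedge A_{i+1}=1$ for $i=1,\dots,r-1$; this is the normal form of $x$. **Super summit set.** $S_x$ is the set of conjugates $y$ of $x$ in $G$ for which $\inf(y)$ is maximal and $\sup(y)$ is minimal among all conjugates of $x$ (this set is finite and nonempty). **Cycling.** If $x$ has normal form $\delta^kA_1\cdots A_r$, put $\mathbf{c}(x)=x$ if $r=0$ and $\mathbf{c}(x)=x^{\tau^{-k}(A_1)}$ otherwise. Cycling maps $S_x$ to itself. **Ultra summit set and trajectories.** $U_x=\{y\in S_x:\mathbf{c}^k(y)=y\text{ for some }k>0\}$. For $y\in S_x$ the trajectory of $y$ is $T_y=\{\mathbf{c}^k(y):k\ge0\}$. **Minimal simple elements.** For $y\in U_x$ let $D_y=\{u\in D\setminus\{1\}: y^u\in U_x\}$ and let $C_y$ be the set of $\preceq$-minimal elements of $D_y$. *)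

theory Defs
  imports "HOL-Algebra.Divisibility" "HOL-Algebra.Lattice"
begin

text \<open>
  Left divisibility in a monoid is the library's \<^const>\<open>factor\<close> (\<open>a divides b\<close> iff \<open>b = a c\<close> for
  some \<open>c\<close>; this does not presuppose commutativity), and left gcds and lcms are \<^const>\<open>isgcd\<close> and
  \<^const>\<open>islcm\<close>.  Atoms are defined separately from the library's \<^const>\<open>irreducible\<close>, which is
  formulated through proper left divisors and units.
\<close>

definition right_divides :: "('a, 'b) monoid_scheme \<Rightarrow> 'a \<Rightarrow> 'a \<Rightarrow> bool" where
  "right_divides M b a \<longleftrightarrow> (\<exists>c\<in>carrier M. a = c \<otimes>\<^bsub>M\<^esub> b)"

definition mprod :: "('a, 'b) monoid_scheme \<Rightarrow> 'a list \<Rightarrow> 'a" where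
  "mprod M xs = foldr (\<otimes>\<^bsub>M\<^esub>) xs \<one>\<^bsub>M\<^esub>"

definition monoid_generated_by :: "('a, 'b) monoid_scheme \<Rightarrow> 'a set \<Rightarrow> bool" where
  "monoid_generated_by M S \<longleftrightarrow>
     S \<subseteq> carrier M \<and> (\<forall>a\<in>carrier M. \<exists>xs. set xs \<subseteq> S \<and> mprod M xs = a)"

definition atoms :: "('a, 'b) monoid_scheme \<Rightarrow> 'a set" where
  "atoms M = {x \<in> carrier M. x \<noteq> \<one>\<^bsub>M\<^esub> \<and>
     (\<forall>a\<in>carrier M. \<forall>b\<in>carrier M. x = a \<otimes>\<^bsub>M\<^esub> b \<longrightarrow> a = \<one>\<^bsub>M\<^esub> \<or> b = \<one>\<^bsub>M\<^esub>)}"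

definition atomic_monoid :: "('a, 'b) monoid_scheme \<Rightarrow> bool" where
  "atomic_monoid M \<longleftrightarrow> monoid_generated_by M (atoms M) \<and>
     (\<forall>a\<in>carrier M. \<exists>N::nat. \<forall>xs. set xs \<subseteq> atoms M \<and> mprod M xs = a \<longrightarrow> length xs \<le> N)"

definition garside_element :: "('a, 'b) monoid_scheme \<Rightarrow> 'a \<Rightarrow> bool" where
  "garside_element M \<delta> \<longleftrightarrow> \<delta> \<in> carrier M \<and>
     {x \<in> carrier M. x divides\<^bsub>M\<^esub> \<delta>} = {x \<in> carrier M. right_divides M x \<delta>} \<and>
     finite {x \<in> carrier M. x divides\<^bsub>M\<^esub> \<delta>} \<and>
     monoid_generated_by M {x \<in> carrier M. x divides\<^bsub>M\<^esub> \<delta>}"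

locale garside_monoid = monoid_cancel M for M (structure) +
  fixes \<delta> :: 'a
  assumes atomic: "atomic_monoid M"
    and garside: "garside_element M \<delta>"
    and gcd_exists: "\<lbrakk>a \<in> carrier M; b \<in> carrier M\<rbrakk> \<Longrightarrow> \<exists>d\<in>carrier M. d gcdof\<^bsub>M\<^esub> a b"
    and lcm_exists: "\<lbrakk>a \<in> carrier M; b \<in> carrier M\<rbrakk> \<Longrightarrow> \<exists>m\<in>carrier M. m lcmof\<^bsub>M\<^esub> a b"

text \<open>
  A Garside group: \<open>M\<close> is the image of the Garside monoid in its group of fractions \<open>G\<close>.  A group
  containing \<open>M\<close> as a submonoid is the group of fractions of \<open>M\<close> iff all its elements are fractions
  of elements of \<open>M\<close>.
\<close>

locale garside_group = group G + submonoid M G for G (structure) and M +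
  fixes \<delta> :: 'a
  assumes garside_monoid: "garside_monoid (G\<lparr>carrier := M\<rparr>) \<delta>"
    and fractions: "g \<in> carrier G \<Longrightarrow> \<exists>a\<in>M. \<exists>b\<in>M. g = a \<otimes> inv b"
begin

definition preceq :: "'a \<Rightarrow> 'a \<Rightarrow> bool" (infix \<open>\<preceq>\<close> 50) where
  "a \<preceq> b \<longleftrightarrow> inv a \<otimes> b \<in> M"

text \<open>Meets and joins for this order structure are the gcd and lcm on \<open>G\<close>.\<close>

definition prefix_order :: "'a gorder" where
  "prefix_order = \<lparr>carrier = carrier G, eq = (=), le = (\<preceq>)\<rparr>"

definition simples :: "'a set" where
  "simples = {x \<in> M. x \<preceq> \<delta>}"

definition conj_by :: "'a \<Rightarrow> 'a \<Rightarrow> 'a" where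
  "conj_by x c = inv c \<otimes> x \<otimes> c"

definition \<tau> :: "'a \<Rightarrow> 'a" where
  "\<tau> x = conj_by x \<delta>"

text \<open>
  The integer powers of the automorphism \<open>\<tau>\<close>; see the lemmas \<open>tau_pow_one\<close>, \<open>tau_pow_zero\<close> and
  \<open>tau_pow_add\<close> below.
\<close>

definition tau_pow :: "int \<Rightarrow> 'a \<Rightarrow> 'a" where
  "tau_pow n x = conj_by x (\<delta> [^] n)"

text \<open>
  If \<open>\<delta> = \<one>\<close>, then \<open>G\<close> is trivial and the infimum and supremum below do not exist (the definitions
  return unspecified integers).  In all other cases the extrema are attained.
\<close>

definition infimum :: "'a \<Rightarrow> int" where
  "infimum x = (GREATEST k. \<delta> [^] k \<preceq> x)"

definition supremum :: "'a \<Rightarrow> int" where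
  "supremum x = (LEAST m. x \<preceq> \<delta> [^] m)"

definition len :: "'a \<Rightarrow> int" where
  "len x = supremum x - infimum x"

definition is_normal_form :: "'a \<Rightarrow> 'a list \<Rightarrow> bool" where
  "is_normal_form x As \<longleftrightarrow>
     set As \<subseteq> simples \<and> int (length As) = len x \<and>
     x = \<delta> [^] infimum x \<otimes> mprod G As \<and>
     (\<forall>i. Suc i < length As \<longrightarrow> (inv (As ! i) \<otimes> \<delta>) \<sqinter>\<^bsub>prefix_order\<^esub> (As ! Suc i) = \<one>)"

definition normal_form :: "'a \<Rightarrow> 'a list" where
  "normal_form x = (THE As. is_normal_form x As)"

definition cycling :: "'a \<Rightarrow> 'a" where
  "cycling x = (if len x = 0 then x
     else conj_by x (tau_pow (- infimum x) (hd (normal_form x))))"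

definition conj_class :: "'a \<Rightarrow> 'a set" where
  "conj_class x = {conj_by x c | c. c \<in> carrier G}"

definition super_summit_set :: "'a \<Rightarrow> 'a set" where
  "super_summit_set x = {y \<in> conj_class x.
     \<forall>z\<in>conj_class x. infimum z \<le> infimum y \<and> supremum y \<le> supremum z}"

definition ultra_summit_set :: "'a \<Rightarrow> 'a set" where
  "ultra_summit_set x = {y \<in> super_summit_set x. \<exists>k>0. (cycling ^^ k) y = y}"

definition trajectory :: "'a \<Rightarrow> 'a set" where
  "trajectory y = {(cycling ^^ k) y | k. True}"

text \<open>
  The sets \<open>D\<^sub>y\<close> and \<open>C\<^sub>y\<close>, defined for \<open>y \<in> U\<^sub>x\<close>.  They depend on the ultra summit set under
  consideration, which is why \<open>x\<close> is an argument.
\<close>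

definition ultra_simples :: "'a \<Rightarrow> 'a \<Rightarrow> 'a set" where
  "ultra_simples x y = {u \<in> simples - {\<one>}. conj_by y u \<in> ultra_summit_set x}"

definition minimal_simples :: "'a \<Rightarrow> 'a \<Rightarrow> 'a set" where
  "minimal_simples x y =
     {u \<in> ultra_simples x y. \<forall>v\<in>ultra_simples x y. v \<preceq> u \<longrightarrow> v = u}"

lemma delta_in_M: "\<delta> \<in> M"
  using garside_monoid unfolding garside_monoid_def garside_monoid_axioms_def garside_element_def
  by simp

lemma delta_in_carrier [simp, intro]: "\<delta> \<in> carrier G"
  using delta_in_M by simp

lemma preceq_iff_divides:
  assumes "a \<in> M" "b \<in> M"
  shows "a \<preceq> b \<longleftrightarrow> a divides\<^bsub>G\<lparr>carrier := M\<rparr>\<^esub> b"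
proof
  assume "a \<preceq> b"
  moreover have "b = a \<otimes> (inv a \<otimes> b)"
    using assms by (simp add: m_assoc [symmetric])
  ultimately show "a divides\<^bsub>G\<lparr>carrier := M\<rparr>\<^esub> b"
    unfolding factor_def preceq_def by auto
next
  assume "a divides\<^bsub>G\<lparr>carrier := M\<rparr>\<^esub> b"
  then obtain c where "c \<in> M" "b = a \<otimes> c"
    unfolding factor_def by auto
  then show "a \<preceq> b"
    unfolding preceq_def using assms by (simp add: m_assoc [symmetric])
qed

lemma tau_pow_one: "x \<in> carrier G \<Longrightarrow> tau_pow 1 x = \<tau> x"
  by (simp add: tau_pow_def \<tau>_def int_pow_1)

lemma tau_pow_zero: "x \<in> carrier G \<Longrightarrow> tau_pow 0 x = x"
  by (simp add: tau_pow_def conj_by_def)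

lemma tau_pow_add:
  "x \<in> carrier G \<Longrightarrow> tau_pow (m + n) x = tau_pow n (tau_pow m x)"
  by (simp add: tau_pow_def conj_by_def int_pow_mult inv_mult_group m_assoc)

end

end

theory Submission
  imports Defs
begin

text \<open>
  Cycling conjugates \<open>y\<close> by \<open>\<iota>(y) = y \<delta>\<^sup>-\<^sup>k \<and> \<delta>\<close> with \<open>k = inf y\<close>; this formula also covers the case
  \<open>len y = 0\<close>.  If \<open>s\<close> conjugates \<open>y\<close> to another element of the super summit set, its transport
  \<open>\<iota>(y)\<^sup>-\<^sup>1 s \<iota>(y\<^sup>s)\<close> conjugates \<open>\<c>(y)\<close> to \<open>\<c>(y\<^sup>s)\<close>.  Transport is monotone and fixes \<open>1\<close> and \<open>\<delta>\<close>,
  hence maps simple elements to simple elements.  As there are finitely many of these, a simple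
  element between two points of the ultra summit set returns to itself after some number of
  transports along closed trajectories.  So transport is injective there and carries minimal simple
  elements along the trajectory.
\<close>

section \<open>Iterates of a function and extrema of sets of integers\<close>

lemma funpow_swap: "(f ^^ m) ((f ^^ n) x) = (f ^^ n) ((f ^^ m) x)"
  using fun_cong[OF funpow_add[of m n f], of x] fun_cong[OF funpow_add[of n m f], of x]
  by (simp add: add.commute)

lemma funpow_mult_fixpoint: "(f ^^ m) x = x \<Longrightarrow> (f ^^ (q * m)) x = x"
  by (induction q) (simp_all add: funpow_add)

text \<open>The candidates above the witness \<open>k\<close> lie in the finite interval from
  \<open>k\<close> to \<open>m\<close>, so \<open>Max\<close> supplies a value that is attained and
  that \<open>Greatest_equality\<close> can identify.\<close>

lemma int_Greatest:
  fixes P :: "int \<Rightarrow> bool"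
  assumes "P k" "\<And>i. P i \<Longrightarrow> i \<le> m"
  shows "P (GREATEST i. P i)" "P i \<Longrightarrow> i \<le> (GREATEST i. P i)"
proof -
  define K where "K = Max {i. P i \<and> k \<le> i}"
  have fin: "finite {i. P i \<and> k \<le> i}" by (rule finite_subset[of _ "{k..m}"]) (use assms in auto)
  have "K \<in> {i. P i \<and> k \<le> i}" unfolding K_def using fin assms(1) by (intro Max_in) auto
  then have K: "P K" "k \<le> K" by auto
  have le: "P i \<Longrightarrow> i \<le> K" for i
    using Max_ge[OF fin, of i] K by (cases "k \<le> i") (auto simp: K_def)
  have "(GREATEST i. P i) = K" using K le by (intro Greatest_equality) auto
  then show "P (GREATEST i. P i)" "P i \<Longrightarrow> i \<le> (GREATEST i. P i)" using K le by auto
qed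

lemma int_Least:
  fixes P :: "int \<Rightarrow> bool"
  assumes "P k" "\<And>i. P i \<Longrightarrow> m \<le> i"
  shows "P (LEAST i. P i)" "P i \<Longrightarrow> (LEAST i. P i) \<le> i"
proof -
  define K where "K = Min {i. P i \<and> i \<le> k}"
  have fin: "finite {i. P i \<and> i \<le> k}" by (rule finite_subset[of _ "{m..k}"]) (use assms in auto)
  have "K \<in> {i. P i \<and> i \<le> k}" unfolding K_def using fin assms(1) by (intro Min_in) auto
  then have K: "P K" "K \<le> k" by auto
  have le: "P i \<Longrightarrow> K \<le> i" for i
    using Min_le[OF fin, of i] K by (cases "i \<le> k") (auto simp: K_def)
  have "(LEAST i. P i) = K" using K le by (intro Least_equality) auto
  then show "P (LEAST i. P i)" "P i \<Longrightarrow> (LEAST i. P i) \<le> i" using K le by auto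
qed

context garside_group
begin

subsection \<open>The prefix order on a Garside group\<close>

lemma inv_mult_cancel [simp]:
  "a \<in> carrier G \<Longrightarrow> b \<in> carrier G \<Longrightarrow> inv a \<otimes> (a \<otimes> b) = b"
  "a \<in> carrier G \<Longrightarrow> b \<in> carrier G \<Longrightarrow> a \<otimes> (inv a \<otimes> b) = b"
  by (simp_all add: m_assoc [symmetric])

lemma conj_by_closed [simp]: "x \<in> carrier G \<Longrightarrow> c \<in> carrier G \<Longrightarrow> conj_by x c \<in> carrier G"
  by (simp add: conj_by_def)

lemma conj_by_one [simp]: "x \<in> carrier G \<Longrightarrow> conj_by x \<one> = x"
  by (simp add: conj_by_def)

lemma conj_by_mult:
  "x \<in> carrier G \<Longrightarrow> c \<in> carrier G \<Longrightarrow> d \<in> carrier G \<Longrightarrow>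
    conj_by x (c \<otimes> d) = conj_by (conj_by x c) d"
  by (simp add: conj_by_def inv_mult_group m_assoc)

lemma mprod_closed: "set xs \<subseteq> M \<Longrightarrow> mprod G xs \<in> M"
  by (induction xs) (simp_all add: mprod_def)

lemma mprod_simps [simp]: "mprod G [] = \<one>" "mprod G (a # xs) = a \<otimes> mprod G xs"
  by (simp_all add: mprod_def)

lemma mprod_append:
  "set xs \<subseteq> M \<Longrightarrow> set ys \<subseteq> M \<Longrightarrow> mprod G (xs @ ys) = mprod G xs \<otimes> mprod G ys"
  by (induction xs) (simp_all add: m_assoc mprod_closed)

lemma mprod_submonoid [simp]: "mprod (G\<lparr>carrier := M\<rparr>) xs = mprod G xs"
  by (simp add: mprod_def)

text \<open>If \<open>a b = 1\<close> with \<open>a \<noteq> 1\<close>, then \<open>1 = (a b)\<^sup>n\<close> has arbitrarily long factorisations into atoms.\<close>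

lemma M_unit_eq_one:
  assumes "a \<in> M" "b \<in> M" "a \<otimes> b = \<one>"
  shows "a = \<one>"
proof (rule ccontr)
  assume "a \<noteq> \<one>"
  let ?A = "atoms (G\<lparr>carrier := M\<rparr>)"
  interpret gm: garside_monoid "G\<lparr>carrier := M\<rparr>" \<delta> by (rule garside_monoid)
  have AM: "?A \<subseteq> M" by (auto simp: atoms_def)
  have gen: "\<exists>xs. set xs \<subseteq> ?A \<and> mprod G xs = c" if "c \<in> M" for c
    using gm.atomic that unfolding atomic_monoid_def monoid_generated_by_def by auto
  obtain xs where xs: "set xs \<subseteq> ?A" "mprod G xs = a" using gen assms(1) by blast
  obtain ys where ys: "set ys \<subseteq> ?A" "mprod G ys = b" using gen assms(2) by blast
  have "\<forall>a\<in>M. \<exists>N. \<forall>zs. set zs \<subseteq> ?A \<and> mprod G zs = a \<longrightarrow> length zs \<le> N"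
    using gm.atomic by (simp add: atomic_monoid_def)
  from bspec[OF this one_closed]
  obtain N where N: "\<forall>zs. set zs \<subseteq> ?A \<and> mprod G zs = \<one> \<longrightarrow> length zs \<le> N" ..
  define w where "w n = concat (replicate n (xs @ ys))" for n
  have w: "set (w n) \<subseteq> ?A \<and> mprod G (w n) = \<one> \<and> length (w n) \<ge> n" for n
  proof (induction n)
    case (Suc n)
    have wS: "w (Suc n) = (xs @ ys) @ w n" by (simp add: w_def)
    have "xs \<noteq> []" using xs \<open>a \<noteq> \<one>\<close> by auto
    then have "length xs \<ge> 1" by (cases xs) auto
    moreover have "set xs \<subseteq> M" "set ys \<subseteq> M" "set (w n) \<subseteq> M" using Suc xs ys AM by auto
    then have "mprod G (w (Suc n)) = \<one>"
      unfolding wS using Suc xs ys assms by (simp add: mprod_append del: append_assoc)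
    moreover have "set (w (Suc n)) \<subseteq> ?A" unfolding wS using Suc xs ys by simp
    moreover have "length (w (Suc n)) = length xs + length ys + length (w n)" by (simp add: wS)
    ultimately show ?case using Suc by simp
  qed (simp add: w_def)
  then show False using N w[of "Suc N"] by (metis not_less_eq_eq)
qed

section \<open>The prefix relation as a left-invariant partial order\<close>

lemma preceq_refl [simp]: "a \<in> carrier G \<Longrightarrow> a \<preceq> a"
  by (simp add: preceq_def)

lemma preceq_trans [trans]:
  assumes "a \<preceq> b" "b \<preceq> c" "a \<in> carrier G" "b \<in> carrier G" "c \<in> carrier G"
  shows "a \<preceq> c"
proof -
  have "inv a \<otimes> c = (inv a \<otimes> b) \<otimes> (inv b \<otimes> c)" using assms by (simp add: m_assoc)
  then show ?thesis using assms unfolding preceq_def by simp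
qed

text \<open>The two quotients are mutually inverse elements of \<open>M\<close>, and
  \<open>M\<close> has no nontrivial units.\<close>

lemma preceq_antisym:
  assumes "a \<preceq> b" "b \<preceq> a" "a \<in> carrier G" "b \<in> carrier G"
  shows "a = b"
proof -
  have "(inv b \<otimes> a) \<otimes> (inv a \<otimes> b) = \<one>" using assms by (simp add: m_assoc)
  then have "inv b \<otimes> a = \<one>" using M_unit_eq_one assms unfolding preceq_def by blast
  then show ?thesis using assms by (metis inv_equality inv_inv inv_closed)
qed

lemma mult_preceq_iff [simp]:
  "a \<in> carrier G \<Longrightarrow> b \<in> carrier G \<Longrightarrow> c \<in> carrier G \<Longrightarrow> c \<otimes> a \<preceq> c \<otimes> b \<longleftrightarrow> a \<preceq> b"
  by (simp add: preceq_def inv_mult_group m_assoc)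

lemma one_preceq_iff [simp]: "a \<in> carrier G \<Longrightarrow> \<one> \<preceq> a \<longleftrightarrow> a \<in> M"
  by (simp add: preceq_def)

lemma preceq_mult_right: "a \<in> carrier G \<Longrightarrow> c \<in> M \<Longrightarrow> a \<preceq> a \<otimes> c"
  by (simp add: preceq_def)

section \<open>Simple elements and the powers of \<tau>\<close>

lemma simples_subset_M: "simples \<subseteq> M"
  by (auto simp: simples_def)

lemma simples_eq_divisors:
  "simples = {a \<in> carrier (G\<lparr>carrier := M\<rparr>). a divides\<^bsub>G\<lparr>carrier := M\<rparr>\<^esub> \<delta>}"
  using preceq_iff_divides delta_in_M by (auto simp: simples_def)

lemma garside_delta: "garside_element (G\<lparr>carrier := M\<rparr>) \<delta>"
  using garside_monoid by (simp add: garside_monoid_def garside_monoid_axioms_def)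

lemma finite_simples: "finite simples"
  using garside_delta unfolding simples_eq_divisors garside_element_def by blast

lemma simples_iff_right: "a \<in> simples \<longleftrightarrow> a \<in> M \<and> (\<exists>c\<in>M. \<delta> = c \<otimes> a)"
proof -
  have "simples = {a \<in> M. right_divides (G\<lparr>carrier := M\<rparr>) a \<delta>}"
    using garside_delta unfolding simples_eq_divisors garside_element_def by simp
  then show ?thesis by (auto simp: right_divides_def)
qed

lemma simples_iff_left: "a \<in> simples \<longleftrightarrow> a \<in> M \<and> (\<exists>c\<in>M. \<delta> = a \<otimes> c)"
  unfolding simples_eq_divisors by (auto simp: factor_def)

lemma M_generated: "a \<in> M \<Longrightarrow> \<exists>xs. set xs \<subseteq> simples \<and> mprod G xs = a"
  using garside_delta unfolding garside_element_def monoid_generated_by_def simples_eq_divisors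
  by auto

text \<open>The complement is a right divisor of \<delta>, and right and left divisors of \<delta>
  coincide.\<close>

lemma complement_simple:
  assumes "a \<in> simples"
  shows "inv a \<otimes> \<delta> \<in> simples"
proof -
  obtain c where c: "c \<in> M" "\<delta> = a \<otimes> c" "a \<in> M" using assms simples_iff_left by auto
  then have "inv a \<otimes> \<delta> = c" by simp
  then show ?thesis using simples_iff_right c by auto
qed

lemma tau_pow_closed [simp]: "a \<in> carrier G \<Longrightarrow> tau_pow n a \<in> carrier G"
  by (simp add: tau_pow_def)

lemma tau_pow_mult:
  "a \<in> carrier G \<Longrightarrow> b \<in> carrier G \<Longrightarrow> tau_pow n (a \<otimes> b) = tau_pow n a \<otimes> tau_pow n b"
  by (simp add: tau_pow_def conj_by_def m_assoc)

lemma tau_pow_of_one: "tau_pow n \<one> = \<one>"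
  by (simp add: tau_pow_def conj_by_def)

text \<open>Conjugation is multiplicative and the simple elements generate \<open>M\<close>, so only
  simple elements have to be checked.\<close>

lemma tau_pow_M_gen:
  assumes "\<And>a. a \<in> simples \<Longrightarrow> tau_pow n a \<in> M" "a \<in> M"
  shows "tau_pow n a \<in> M"
proof -
  have "set xs \<subseteq> simples \<Longrightarrow> tau_pow n (mprod G xs) \<in> M" for xs
  proof (induction xs)
    case (Cons b xs)
    then have "b \<in> M" "mprod G xs \<in> M"
      using simples_subset_M mprod_closed by auto
    then show ?case using Cons assms(1) by (simp add: tau_pow_mult)
  qed (simp add: tau_pow_of_one)
  then show ?thesis using M_generated assms(2) by blast
qed

text \<open>If \<delta> = a b, then b is simple, so \<delta> = b c and a \<delta> = a b c = \<delta>
  c; hence c is the conjugate of a by \<delta>. Complements taken on the left give the inverse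
  conjugation.\<close>

lemma tau_M:
  assumes "a \<in> M"
  shows "tau_pow 1 a \<in> M" "tau_pow (-1) a \<in> M"
proof -
  have "tau_pow 1 a \<in> M" if a: "a \<in> simples" for a
  proof -
    obtain b where b: "b \<in> M" "\<delta> = a \<otimes> b" "a \<in> M" using a simples_iff_left by auto
    then have "b \<in> simples" using simples_iff_right by auto
    then obtain c where c: "c \<in> M" "\<delta> = b \<otimes> c" using simples_iff_left by auto
    have "tau_pow 1 a = inv \<delta> \<otimes> (a \<otimes> \<delta>)" using b(1,3) by (simp add: tau_pow_def conj_by_def m_assoc)
    also have "a \<otimes> \<delta> = a \<otimes> b \<otimes> c" using b(1,3) c by (simp add: m_assoc)
    also have "\<dots> = \<delta> \<otimes> c" using b(2) by simp
    finally show ?thesis using c(1) by simp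
  qed
  then show "tau_pow 1 a \<in> M" using assms tau_pow_M_gen by blast
next
  have "tau_pow (-1) a \<in> M" if a: "a \<in> simples" for a
  proof -
    obtain b where b: "b \<in> M" "\<delta> = b \<otimes> a" "a \<in> M" using a simples_iff_right by auto
    then have "b \<in> simples" using simples_iff_left by auto
    then obtain c where c: "c \<in> M" "\<delta> = c \<otimes> b" using simples_iff_right by auto
    have "tau_pow (-1) a = \<delta> \<otimes> a \<otimes> inv \<delta>"
      using b(1,3) by (simp add: tau_pow_def conj_by_def int_pow_neg)
    also have "\<delta> \<otimes> a = c \<otimes> (b \<otimes> a)" using b(1,3) c by (simp add: m_assoc)
    also have "\<dots> = c \<otimes> \<delta>" using b(2) by simp
    finally show ?thesis using c(1) by (simp add: m_assoc)
  qed
  then show "tau_pow (-1) a \<in> M" using assms tau_pow_M_gen by blast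
qed

lemma tau_pow_M: "a \<in> M \<Longrightarrow> tau_pow n a \<in> M"
proof (induction n rule: int_induct[of _ 0])
  case base then show ?case by (simp add: tau_pow_zero)
next
  case (step1 i)
  then show ?case using tau_M(1) by (simp add: tau_pow_add)
next
  case (step2 i)
  then show ?case using tau_M(2) tau_pow_add[of a i "-1"] by simp
qed

lemma tau_pow_M_iff [simp]: "a \<in> carrier G \<Longrightarrow> tau_pow n a \<in> M \<longleftrightarrow> a \<in> M"
  using tau_pow_M[of a n] tau_pow_M[of "tau_pow n a" "-n"] tau_pow_add[of a n "-n"]
  by (auto simp: tau_pow_zero)

lemma mult_delta_pow: "a \<in> carrier G \<Longrightarrow> a \<otimes> \<delta> [^] n = \<delta> [^] (n::int) \<otimes> tau_pow n a"
  by (simp add: tau_pow_def conj_by_def m_assoc)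

text \<open>Multiplying both sides on the right by \<delta>^n changes their quotient only by
  \<open>tau_pow n\<close>, which preserves \<open>M\<close>.\<close>

lemma preceq_mult_delta_pow [simp]:
  assumes "a \<in> carrier G" "b \<in> carrier G"
  shows "a \<otimes> \<delta> [^] (n::int) \<preceq> b \<otimes> \<delta> [^] n \<longleftrightarrow> a \<preceq> b"
proof -
  have "inv (a \<otimes> \<delta> [^] n) \<otimes> (b \<otimes> \<delta> [^] n) = tau_pow n (inv a \<otimes> b)"
    using assms by (simp add: tau_pow_def conj_by_def inv_mult_group m_assoc)
  then show ?thesis using assms by (simp add: preceq_def)
qed

section \<open>Bounds by powers of \<delta>\<close>

lemma delta_pow_M: "0 \<le> n \<Longrightarrow> \<delta> [^] (n::int) \<in> M"
proof (induction n rule: int_ge_induct)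
  case (step i)
  then show ?case using delta_in_M by (simp add: int_pow_mult)
qed simp

text \<open>A product of n simple elements is at most \<delta>^n: by induction the tail is enlarged
  to a power of \<delta>, and then the first factor can be enlarged to \<delta> because the order is
  also invariant under right multiplication by that power.\<close>

lemma M_preceq_delta_pow:
  assumes "a \<in> M"
  shows "\<exists>n::nat. a \<preceq> \<delta> [^] int n"
proof -
  have "mprod G xs \<preceq> \<delta> [^] int (length xs)" if "set xs \<subseteq> simples" for xs
    using that
  proof (induction xs)
    case (Cons b xs)
    then have M: "b \<in> M" "mprod G xs \<in> M" "b \<preceq> \<delta>" "mprod G xs \<preceq> \<delta> [^] int (length xs)"
      using simples_subset_M mprod_closed by (auto simp: simples_def)
    have "b \<otimes> mprod G xs \<preceq> b \<otimes> \<delta> [^] int (length xs)" using M by simp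
    also have "b \<otimes> \<delta> [^] int (length xs) \<preceq> \<delta> \<otimes> \<delta> [^] int (length xs)" using M by simp
    also have "\<delta> \<otimes> \<delta> [^] int (length xs) = \<delta> [^] int (length (b # xs))"
      using int_pow_mult[of \<delta> 1 "int (length xs)"] by simp
    finally show ?case using M by simp
  qed simp
  then show ?thesis using M_generated[OF assms] by blast
qed

lemma preceq_delta_pow:
  assumes "g \<in> carrier G"
  shows "\<exists>n::nat. g \<preceq> \<delta> [^] int n"
proof -
  obtain a b where ab: "a \<in> M" "b \<in> M" "g = a \<otimes> inv b" using fractions[OF assms] by blast
  obtain n :: nat where "a \<preceq> \<delta> [^] int n" using M_preceq_delta_pow ab by blast
  moreover have "g \<preceq> a" using ab by (simp add: preceq_def inv_mult_group m_assoc)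
  ultimately have "g \<preceq> \<delta> [^] int n"
    using preceq_trans[of g a] ab(1) assms by simp
  then show ?thesis by blast
qed

text \<open>The upper bound for the inverse of g puts g \<delta>^n into \<open>M\<close>;
  conjugation by a power of \<delta> then moves \<delta>^n to the left of g.\<close>

lemma delta_pow_preceq:
  assumes "g \<in> carrier G"
  shows "\<exists>n::nat. \<delta> [^] (- int n) \<preceq> g"
proof -
  obtain n :: nat where n: "inv g \<preceq> \<delta> [^] int n" using preceq_delta_pow assms by blast
  then have "g \<otimes> \<delta> [^] int n \<in> M" using assms by (simp add: preceq_def)
  then have "\<delta> [^] int n \<otimes> tau_pow (int n) g \<in> M" using assms by (simp add: mult_delta_pow)
  then have "tau_pow (- int n) (\<delta> [^] int n \<otimes> tau_pow (int n) g) \<in> M" by (rule tau_pow_M)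
  moreover have "tau_pow (- int n) (\<delta> [^] int n \<otimes> tau_pow (int n) g) = \<delta> [^] int n \<otimes> g"
    using assms by (simp add: tau_pow_def conj_by_def m_assoc int_pow_neg)
  ultimately have "\<delta> [^] int n \<otimes> g \<in> M" by simp
  then show ?thesis using assms by (auto simp: preceq_def int_pow_neg)
qed

section \<open>Greatest common prefixes in the group\<close>

abbreviation lgcd :: "'a \<Rightarrow> 'a \<Rightarrow> 'a" where
  "lgcd a b \<equiv> a \<sqinter>\<^bsub>prefix_order\<^esub> b"

lemma glb_M:
  assumes "a \<in> M" "b \<in> M"
  obtains d where "d \<in> M" "d \<preceq> a" "d \<preceq> b" "\<And>c. c \<in> M \<Longrightarrow> c \<preceq> a \<Longrightarrow> c \<preceq> b \<Longrightarrow> c \<preceq> d"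
proof -
  interpret gm: garside_monoid "G\<lparr>carrier := M\<rparr>" \<delta> by (rule garside_monoid)
  obtain d where "d \<in> M" "d gcdof\<^bsub>G\<lparr>carrier := M\<rparr>\<^esub> a b"
    using gm.gcd_exists assms by auto
  then show ?thesis using that[of d] assms by (auto simp: isgcd_def preceq_iff_divides)
qed

text \<open>
  Multiplying by a power of \<open>\<delta>\<close> moves \<open>a\<close> and \<open>b\<close> into \<open>M\<close>.  A lower bound \<open>c\<close> may need a larger power,
  and the gcds for the two powers are compared.
\<close>

lemma glb_exists:
  assumes a: "a \<in> carrier G" and b: "b \<in> carrier G"
  shows "\<exists>d\<in>carrier G. d \<preceq> a \<and> d \<preceq> b \<and> (\<forall>c\<in>carrier G. c \<preceq> a \<longrightarrow> c \<preceq> b \<longrightarrow> c \<preceq> d)"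
proof -
  have shift: "\<delta> [^] int (m + n) \<otimes> g \<in> M" if "\<delta> [^] (- int n) \<preceq> g" "g \<in> carrier G" for g m n
  proof -
    have "\<delta> [^] int n \<otimes> g \<in> M" using that by (simp add: preceq_def int_pow_neg)
    moreover have "\<delta> [^] int (m + n) \<otimes> g = \<delta> [^] int m \<otimes> (\<delta> [^] int n \<otimes> g)"
      using that by (simp add: int_pow_mult m_assoc)
    ultimately show ?thesis using delta_pow_M by simp
  qed
  obtain na where na: "\<delta> [^] (- int na) \<preceq> a" using delta_pow_preceq a by blast
  obtain nb where nb: "\<delta> [^] (- int nb) \<preceq> b" using delta_pow_preceq b by blast
  define P where "P = \<delta> [^] int (na + nb)"
  have P: "P \<in> carrier G" by (simp add: P_def)
  have PM: "P \<otimes> a \<in> M" "P \<otimes> b \<in> M"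
    using shift[OF na a, of nb] shift[OF nb b, of na] by (simp_all add: P_def add.commute)
  then obtain d where d: "d \<in> M" "d \<preceq> P \<otimes> a" "d \<preceq> P \<otimes> b"
    "\<And>c. c \<in> M \<Longrightarrow> c \<preceq> P \<otimes> a \<Longrightarrow> c \<preceq> P \<otimes> b \<Longrightarrow> c \<preceq> d" using glb_M by blast
  have "c \<preceq> inv P \<otimes> d" if c: "c \<in> carrier G" "c \<preceq> a" "c \<preceq> b" for c
  proof -
    obtain j where j: "\<delta> [^] (- int j) \<preceq> c" using delta_pow_preceq c by blast
    define Q where "Q = \<delta> [^] int j"
    have Q: "Q \<in> carrier G" "Q \<in> M" using delta_pow_M by (simp_all add: Q_def)
    have QP: "Q \<otimes> P = \<delta> [^] int (na + nb + j)" "P \<otimes> Q = \<delta> [^] int (na + nb + j)"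
      by (simp_all add: Q_def P_def int_pow_mult [symmetric] algebra_simps)
    obtain e where e: "e \<in> M" "e \<preceq> Q \<otimes> (P \<otimes> a)" "e \<preceq> Q \<otimes> (P \<otimes> b)"
      "\<And>c. c \<in> M \<Longrightarrow> c \<preceq> Q \<otimes> (P \<otimes> a) \<Longrightarrow> c \<preceq> Q \<otimes> (P \<otimes> b) \<Longrightarrow> c \<preceq> e"
      using glb_M PM Q by (metis m_closed)
    have eC: "e \<in> carrier G" "d \<in> carrier G" using e d by auto
    \<comment> \<open>\<open>Q\<close> is itself a common divisor of the two elements whose gcd is
      \<open>e\<close>. Cancelling it from \<open>e\<close> leaves a common divisor in
      \<open>M\<close> of the elements whose gcd is \<open>d\<close>.\<close>
    have "Q \<preceq> e" using e(4)[of Q] Q PM preceq_mult_right by auto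
    then have "inv Q \<otimes> e \<in> M" by (simp add: preceq_def)
    moreover have "inv Q \<otimes> e \<preceq> P \<otimes> a" "inv Q \<otimes> e \<preceq> P \<otimes> b"
      using e(2,3) mult_preceq_iff[of "inv Q \<otimes> e" "P \<otimes> a" Q] mult_preceq_iff[of "inv Q \<otimes> e" "P \<otimes> b" Q]
        Q P a b eC by simp_all
    ultimately have ed: "inv Q \<otimes> e \<preceq> d" using d(4) by blast
    \<comment> \<open>The extra power \<open>Q\<close> was chosen to move \<open>c\<close> into
      \<open>M\<close>, where the gcd property of \<open>e\<close> applies to it.\<close>
    have "Q \<otimes> P \<otimes> c \<in> M" using shift[OF j c(1), of "na + nb"] QP by simp
    then have "Q \<otimes> (P \<otimes> c) \<in> M" using Q P c by (simp add: m_assoc)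
    then have "Q \<otimes> (P \<otimes> c) \<preceq> e" using e(4) Q P a b c by simp
    then have "P \<otimes> c \<preceq> inv Q \<otimes> e"
      using mult_preceq_iff[of "P \<otimes> c" "inv Q \<otimes> e" Q] Q P c eC by simp
    then have "P \<otimes> c \<preceq> d" using ed preceq_trans Q P c eC by (meson inv_closed monoid.m_closed monoid_axioms)
    then show ?thesis using mult_preceq_iff[of c "inv P \<otimes> d" P] P c eC by simp
  qed
  moreover have "inv P \<otimes> d \<preceq> a" "inv P \<otimes> d \<preceq> b"
    using d mult_preceq_iff[of "inv P \<otimes> d" a P] mult_preceq_iff[of "inv P \<otimes> d" b P] P a b by simp_all
  ultimately show ?thesis using P d by (intro bexI[of _ "inv P \<otimes> d"]) auto
qed

text \<open>This makes the meet that occurs in \<open>is_normal_form\<close> a genuine greatest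
  lower bound.\<close>

lemma lower_semilattice_prefix_order: "lower_semilattice prefix_order"
proof
  fix a b assume "a \<in> carrier prefix_order" "b \<in> carrier prefix_order"
  then obtain d where "d \<in> carrier G" "d \<preceq> a" "d \<preceq> b"
    "\<forall>c\<in>carrier G. c \<preceq> a \<longrightarrow> c \<preceq> b \<longrightarrow> c \<preceq> d" "a \<in> carrier G" "b \<in> carrier G"
    using glb_exists[of a b] by (auto simp: prefix_order_def)
  then show "\<exists>d. greatest prefix_order d (Lower prefix_order {a, b})"
    by (intro exI[of _ d]) (auto simp: prefix_order_def greatest_def Lower_def)
qed (auto simp: prefix_order_def intro: preceq_antisym preceq_trans)

lemma lgcd_closed [simp]: "a \<in> carrier G \<Longrightarrow> b \<in> carrier G \<Longrightarrow> lgcd a b \<in> carrier G"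
  and lgcd_left: "a \<in> carrier G \<Longrightarrow> b \<in> carrier G \<Longrightarrow> lgcd a b \<preceq> a"
  and lgcd_right: "a \<in> carrier G \<Longrightarrow> b \<in> carrier G \<Longrightarrow> lgcd a b \<preceq> b"
  and lgcd_greatest:
    "c \<preceq> a \<Longrightarrow> c \<preceq> b \<Longrightarrow> a \<in> carrier G \<Longrightarrow> b \<in> carrier G \<Longrightarrow> c \<in> carrier G \<Longrightarrow> c \<preceq> lgcd a b"
proof -
  interpret L: lower_semilattice prefix_order by (rule lower_semilattice_prefix_order)
  show "a \<in> carrier G \<Longrightarrow> b \<in> carrier G \<Longrightarrow> lgcd a b \<in> carrier G"
    using L.meet_closed[of a b] by (simp add: prefix_order_def)
  show "a \<in> carrier G \<Longrightarrow> b \<in> carrier G \<Longrightarrow> lgcd a b \<preceq> a"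
    using L.meet_left[of a b] by (simp add: prefix_order_def)
  show "a \<in> carrier G \<Longrightarrow> b \<in> carrier G \<Longrightarrow> lgcd a b \<preceq> b"
    using L.meet_right[of a b] by (simp add: prefix_order_def)
  show "c \<preceq> a \<Longrightarrow> c \<preceq> b \<Longrightarrow> a \<in> carrier G \<Longrightarrow> b \<in> carrier G \<Longrightarrow> c \<in> carrier G \<Longrightarrow> c \<preceq> lgcd a b"
    using L.meet_le[of c a b] by (simp add: prefix_order_def)
qed

lemma lgcd_eqI:
  assumes "c \<preceq> a" "c \<preceq> b" "\<And>d. d \<in> carrier G \<Longrightarrow> d \<preceq> a \<Longrightarrow> d \<preceq> b \<Longrightarrow> d \<preceq> c"
    "a \<in> carrier G" "b \<in> carrier G" "c \<in> carrier G"
  shows "lgcd a b = c"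
  using assms by (intro preceq_antisym lgcd_greatest) (auto simp: lgcd_left lgcd_right)

text \<open>Right multiplication by a power of \<delta> is an order automorphism of the group, so it
  commutes with gcds.\<close>

lemma preceq_lgcd_mult_delta_pow:
  assumes "c \<preceq> a \<otimes> \<delta> [^] n" "c \<preceq> b \<otimes> \<delta> [^] n"
    and [simp]: "a \<in> carrier G" "b \<in> carrier G" "c \<in> carrier G"
  shows "c \<preceq> lgcd a b \<otimes> \<delta> [^] (n::int)"
proof -
  define d where "d = c \<otimes> \<delta> [^] (- n)"
  have [simp]: "d \<in> carrier G" by (simp add: d_def)
  have c: "c = d \<otimes> \<delta> [^] n" by (simp add: d_def m_assoc int_pow_neg)
  show ?thesis using assms(1,2) by (simp add: c lgcd_greatest)
qed

lemma tau_pow_preceq_iff [simp]: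
  "a \<in> carrier G \<Longrightarrow> b \<in> carrier G \<Longrightarrow> tau_pow n a \<preceq> tau_pow n b \<longleftrightarrow> a \<preceq> b"
proof -
  assume ab: "a \<in> carrier G" "b \<in> carrier G"
  then have "inv (tau_pow n a) \<otimes> tau_pow n b = tau_pow n (inv a \<otimes> b)"
    by (simp add: tau_pow_def conj_by_def inv_mult_group m_assoc)
  then show ?thesis using ab by (simp add: preceq_def)
qed

lemma tau_pow_lgcd:
  assumes "a \<in> carrier G" "b \<in> carrier G"
  shows "tau_pow n (lgcd a b) = lgcd (tau_pow n a) (tau_pow n b)"
proof (rule lgcd_eqI [symmetric])
  fix d assume d: "d \<in> carrier G" "d \<preceq> tau_pow n a" "d \<preceq> tau_pow n b"
  have eq: "d = tau_pow n (tau_pow (- n) d)"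
    using tau_pow_add[of d "- n" n] d by (simp add: tau_pow_zero)
  have "tau_pow (- n) d \<preceq> lgcd a b"
    using d assms eq by (metis lgcd_greatest tau_pow_preceq_iff tau_pow_closed)
  then show "d \<preceq> tau_pow n (lgcd a b)"
    using d assms eq by (metis lgcd_closed tau_pow_preceq_iff tau_pow_closed)
qed (use assms in \<open>simp_all add: lgcd_left lgcd_right\<close>)

lemma tau_pow_delta_pow [simp]: "tau_pow n (\<delta> [^] k) = \<delta> [^] (k::int)"
proof -
  have "tau_pow n (\<delta> [^] k) = \<delta> [^] (- n + k + n)"
    by (simp only: tau_pow_def conj_by_def int_pow_neg int_pow_mult delta_in_carrier)
  then show ?thesis by simp
qed

lemma tau_pow_delta [simp]: "tau_pow n \<delta> = \<delta>"
  using tau_pow_delta_pow[of n 1] by simp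

lemma simplesD:
  assumes "a \<in> simples"
  shows "a \<in> M" "a \<in> carrier G" "a \<preceq> \<delta>"
  using assms by (auto simp: simples_def)

subsection \<open>Normal forms and cycling\<close>

definition greedy :: "'a list \<Rightarrow> bool" where
  "greedy As \<longleftrightarrow> (\<forall>i. Suc i < length As \<longrightarrow> lgcd (inv (As ! i) \<otimes> \<delta>) (As ! Suc i) = \<one>)"

lemma greedy_Cons: "greedy (a # b # As) \<longleftrightarrow> lgcd (inv a \<otimes> \<delta>) b = \<one> \<and> greedy (b # As)"
  unfolding greedy_def by (auto simp: less_Suc_eq_0_disj nth_Cons split: nat.splits)

lemma greedy_tl: "greedy (a # As) \<Longrightarrow> greedy As"
  by (cases As) (simp_all add: greedy_Cons, simp add: greedy_def)

text \<open>Let d lie below the product and below \<delta>, and cancel the head a from it. The rest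
  lies below the tail product and below the complement of a, which is simple; by induction it lies
  below the next factor, so greediness forces it below 1.\<close>

lemma greedy_hd:
  assumes "set As \<subseteq> simples" "As \<noteq> []" "greedy As"
  shows "hd As = lgcd (mprod G As) \<delta>"
  using assms
proof (induction As)
  case (Cons a As)
  then have a: "a \<in> simples" "a \<in> M" "a \<in> carrier G" "a \<preceq> \<delta>" using simplesD by auto
  have "set As \<subseteq> M" using Cons.prems simples_subset_M by auto
  then have P: "mprod G As \<in> M" by (rule mprod_closed)
  have "d \<preceq> a" if d: "d \<in> carrier G" "d \<preceq> a \<otimes> mprod G As" "d \<preceq> \<delta>" for d
  proof -
    have d': "inv a \<otimes> d \<preceq> mprod G As" "inv a \<otimes> d \<preceq> inv a \<otimes> \<delta>"
      using d a P mult_preceq_iff[of "inv a \<otimes> d" "mprod G As" a] by simp_all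
    have "inv a \<otimes> d \<preceq> \<one>"
    proof (cases As)
      case Nil then show ?thesis using d' by simp
    next
      case [simp]: (Cons b Bs)
      have b: "b \<in> carrier G" "lgcd (inv a \<otimes> \<delta>) b = \<one>" "b = lgcd (mprod G As) \<delta>"
        using Cons.IH Cons.prems simplesD by (auto simp: greedy_Cons)
      have "inv a \<otimes> d \<preceq> \<delta>"
        using preceq_trans[OF d'(2) simplesD(3)[OF complement_simple[OF a(1)]]] d(1) a by simp
      then have "inv a \<otimes> d \<preceq> b"
        unfolding b(3) using d' d a P by (intro lgcd_greatest) auto
      then have "inv a \<otimes> d \<preceq> lgcd (inv a \<otimes> \<delta>) b"
        using d' d a b(1) by (intro lgcd_greatest) auto
      then show ?thesis by (simp add: b(2))
    qed
    then show ?thesis using mult_preceq_iff[of "inv a \<otimes> d" \<one> a] d a by simp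
  qed
  then have "lgcd (a \<otimes> mprod G As) \<delta> = a"
    using a P preceq_mult_right by (intro lgcd_eqI) auto
  then show ?case by simp
qed simp

text \<open>By \<open>greedy_hd\<close> the product determines the head, which can be cancelled. The
  lengths have to agree because appending the factor 1 keeps a list greedy.\<close>

lemma greedy_unique:
  assumes "length As = length Bs" "set As \<subseteq> simples" "set Bs \<subseteq> simples"
    "greedy As" "greedy Bs" "mprod G As = mprod G Bs"
  shows "As = Bs"
  using assms
proof (induction rule: list_induct2)
  case (Cons a As b Bs)
  have eq: "a = b"
    using greedy_hd[of "a # As"] greedy_hd[of "b # Bs"] Cons.prems by simp
  have "set As \<subseteq> M" "set Bs \<subseteq> M" using Cons.prems simples_subset_M by auto
  then have "mprod G As \<in> carrier G" "mprod G Bs \<in> carrier G" using mprod_closed by auto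
  moreover have "b \<in> carrier G" using Cons.prems simplesD by auto
  ultimately have "mprod G As = mprod G Bs" using Cons.prems eq by simp
  then show ?case using Cons eq greedy_tl by auto
qed simp

text \<open>Split off the gcd A of P and \<delta>. As P lies below both P \<delta>^n and \<delta>
  \<delta>^n, it lies below A \<delta>^n, so the remaining factor lies below \<delta>^n. Factors
  equal to 1 may occur, which allows the length to be exactly n.\<close>

lemma greedy_exists:
  assumes "P \<in> M" "P \<preceq> \<delta> [^] int n"
  shows "\<exists>As. set As \<subseteq> simples \<and> length As = n \<and> mprod G As = P \<and> greedy As"
  using assms
proof (induction n arbitrary: P)
  case 0
  then have "P = \<one>" using preceq_antisym[of P \<one>] by simp
  then show ?case by (intro exI[of _ "[]"]) (simp add: greedy_def)
next
  case (Suc n)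
  define A where "A = lgcd P \<delta>"
  define Q where "Q = inv A \<otimes> P"
  have A: "A \<in> carrier G" "A \<preceq> P" "A \<preceq> \<delta>"
    using Suc.prems by (simp_all add: A_def lgcd_left lgcd_right)
  have "\<one> \<preceq> A" unfolding A_def using Suc.prems delta_in_M by (intro lgcd_greatest) auto
  then have AS: "A \<in> simples" using A by (simp add: simples_def)
  have Q: "Q \<in> M" using A by (simp add: Q_def preceq_def)
  have P: "P = A \<otimes> Q" "P \<in> carrier G" using A Suc.prems by (simp_all add: Q_def)
  have "\<delta> [^] int (Suc n) = \<delta> \<otimes> \<delta> [^] int n"
    using int_pow_mult[of \<delta> 1 "int n"] by simp
  then have "P \<preceq> A \<otimes> \<delta> [^] int n" unfolding A_def
    using Suc.prems delta_pow_M preceq_mult_right by (intro preceq_lgcd_mult_delta_pow) auto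
  then have "Q \<preceq> \<delta> [^] int n" using A Q by (simp add: P(1))
  then obtain As where As: "set As \<subseteq> simples" "length As = n" "mprod G As = Q" "greedy As"
    using Suc.IH Q by blast
  have "greedy (A # As)"
  proof (cases As)
    case [simp]: (Cons b Bs)
    have "b = lgcd Q \<delta>" using greedy_hd[of As] As by simp
    then have b: "b \<preceq> Q" "b \<in> M" "b \<in> carrier G" using Q lgcd_left simplesD As by auto
    \<comment> \<open>A common prefix d could be absorbed into \<open>A\<close>: then A d lies below
      P and \<delta>, hence below their gcd \<open>A\<close>.\<close>
    have "lgcd (inv A \<otimes> \<delta>) b = \<one>"
    proof (rule lgcd_eqI)
      fix d assume d: "d \<in> carrier G" "d \<preceq> inv A \<otimes> \<delta>" "d \<preceq> b"
      have "d \<preceq> Q" using preceq_trans[OF d(3) b(1)] d(1) b(3) Q by simp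
      then have "A \<otimes> d \<preceq> P" using A d Q by (simp add: P(1))
      moreover have "A \<otimes> d \<preceq> \<delta>"
        using mult_preceq_iff[of d "inv A \<otimes> \<delta>" A] A d by simp
      ultimately have "A \<otimes> d \<preceq> A"
        unfolding A_def by (intro lgcd_greatest) (use d P A in \<open>auto simp: A_def [symmetric]\<close>)
      then show "d \<preceq> \<one>" using mult_preceq_iff[of d \<one> A] A d by simp
    qed (use A b in \<open>simp_all add: preceq_def\<close>)
    then show ?thesis using As by (simp add: greedy_Cons)
  qed (simp add: greedy_def)
  then show ?case using As AS P by (intro exI[of _ "A # As"]) simp
qed

section \<open>Initial factors, conjugacy classes and super summit sets\<close>

lemma infimum_tau: "y \<in> carrier G \<Longrightarrow> infimum (tau_pow n y) = infimum y"
  using tau_pow_preceq_iff[of "\<delta> [^] (k::int)" y n for k] by (simp add: infimum_def)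

lemma supremum_tau: "y \<in> carrier G \<Longrightarrow> supremum (tau_pow n y) = supremum y"
  using tau_pow_preceq_iff[of y "\<delta> [^] (k::int)" n for k] by (simp add: supremum_def)

text \<open>The conjugator \<iota>(y), expressed without the normal form; \<open>cycling_eq\<close>
  links it to \<open>cycling\<close>.\<close>

definition initial_factor :: "'a \<Rightarrow> 'a" where
  "initial_factor y = lgcd (y \<otimes> \<delta> [^] (- infimum y)) \<delta>"

lemma initial_factor_closed [simp]: "y \<in> carrier G \<Longrightarrow> initial_factor y \<in> carrier G"
  by (simp add: initial_factor_def)

lemma initial_factor_tau:
  "y \<in> carrier G \<Longrightarrow> initial_factor (tau_pow n y) = tau_pow n (initial_factor y)"
  by (simp add: initial_factor_def infimum_tau tau_pow_lgcd tau_pow_mult)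

lemma conj_class_closed: "x \<in> carrier G \<Longrightarrow> y \<in> conj_class x \<Longrightarrow> y \<in> carrier G"
  by (auto simp: conj_class_def)

lemma conj_class_conj_by:
  assumes "x \<in> carrier G" "y \<in> conj_class x" "c \<in> carrier G"
  shows "conj_by y c \<in> conj_class x"
proof -
  obtain d where "d \<in> carrier G" "y = conj_by x d" using assms by (auto simp: conj_class_def)
  then have "conj_by y c = conj_by x (d \<otimes> c)" "d \<otimes> c \<in> carrier G"
    using assms by (simp_all add: conj_by_mult)
  then show ?thesis by (auto simp only: conj_class_def)
qed

lemma super_summit_setI:
  assumes "y \<in> super_summit_set x" "z \<in> conj_class x" "infimum y \<le> infimum z"
    "supremum z \<le> supremum y"
  shows "z \<in> super_summit_set x"
  using assms unfolding super_summit_set_def by fastforce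

lemma super_summit_set_infimum:
  "y \<in> super_summit_set x \<Longrightarrow> z \<in> super_summit_set x \<Longrightarrow> infimum y = infimum z"
  unfolding super_summit_set_def by (auto intro: antisym)

lemma super_summit_set_closed: "x \<in> carrier G \<Longrightarrow> y \<in> super_summit_set x \<Longrightarrow> y \<in> carrier G"
  using conj_class_closed by (auto simp: super_summit_set_def)

text \<open>This admits \<delta> as an argument of \<open>transport_mono\<close>, which yields the
  upper bound in \<open>transport_simples\<close>.\<close>

lemma super_summit_set_tau:
  assumes "x \<in> carrier G" "y \<in> super_summit_set x"
  shows "conj_by y \<delta> \<in> super_summit_set x"
proof (rule super_summit_setI[OF assms(2)])
  have y: "y \<in> carrier G" using super_summit_set_closed assms by blast
  have "conj_by y \<delta> = tau_pow 1 y" by (simp add: tau_pow_def)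
  then show "infimum y \<le> infimum (conj_by y \<delta>)" "supremum (conj_by y \<delta>) \<le> supremum y"
    using y by (simp_all add: infimum_tau supremum_tau)
  show "conj_by y \<delta> \<in> conj_class x"
    using assms by (simp add: conj_class_conj_by super_summit_set_def)
qed

end

text \<open>Excludes the degenerate case, where all powers of \<delta> coincide and
  \<open>infimum\<close> and \<open>supremum\<close> are unspecified.\<close>

locale nontrivial_garside_group = garside_group +
  assumes delta_not_one: "\<delta> \<noteq> \<one>"
begin

section \<open>Attainment of infimum and supremum\<close>

lemma delta_pow_preceq_iff: "\<delta> [^] (k::int) \<preceq> \<delta> [^] (m::int) \<longleftrightarrow> k \<le> m"
proof
  assume "k \<le> m"
  then show "\<delta> [^] k \<preceq> \<delta> [^] m"
    using delta_pow_M[of "m - k"] int_pow_mult[of \<delta> "- k" m]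
    by (simp add: preceq_def int_pow_neg)
next
  assume le: "\<delta> [^] k \<preceq> \<delta> [^] m"
  show "k \<le> m"
  proof (rule ccontr)
    \<comment> \<open>Then \<delta>^(k-m) and its inverse both lie in \<open>M\<close>, so this
      power is 1; splitting off one factor makes \<delta> itself a unit of \<open>M\<close>.\<close>
    assume "\<not> k \<le> m"
    then have 1: "\<delta> [^] (k - m) \<in> M" "\<delta> [^] (k - m - 1) \<in> M" using delta_pow_M by simp_all
    have 2: "\<delta> [^] (m - k) \<in> M"
      using le int_pow_mult[of \<delta> "- k" m] by (simp add: preceq_def int_pow_neg)
    have "\<delta> [^] (k - m) \<otimes> \<delta> [^] (m - k) = \<one>" by (simp add: int_pow_mult [symmetric])
    then have "\<delta> [^] (k - m) = \<one>" using M_unit_eq_one 1 2 by blast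
    then have "\<delta> \<otimes> \<delta> [^] (k - m - 1) = \<one>"
      using int_pow_mult[of \<delta> 1 "k - m - 1"] by simp
    then show False using M_unit_eq_one 1 delta_in_M delta_not_one by blast
  qed
qed

lemma delta_pow_preceq_bounded:
  assumes "g \<in> carrier G"
  shows "\<exists>m. \<forall>i. \<delta> [^] (i::int) \<preceq> g \<longrightarrow> i \<le> m" "\<exists>m. \<forall>i. g \<preceq> \<delta> [^] (i::int) \<longrightarrow> m \<le> i"
proof -
  obtain k m :: int where km: "\<delta> [^] k \<preceq> g" "g \<preceq> \<delta> [^] m"
    using preceq_delta_pow delta_pow_preceq assms by blast
  have "i \<le> m" if "\<delta> [^] i \<preceq> g" for i :: int
    using preceq_trans[OF that km(2)] assms by (simp add: delta_pow_preceq_iff)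
  then show "\<exists>m. \<forall>i. \<delta> [^] (i::int) \<preceq> g \<longrightarrow> i \<le> m" by blast
  have "k \<le> i" if "g \<preceq> \<delta> [^] i" for i :: int
    using preceq_trans[OF km(1) that] assms by (simp add: delta_pow_preceq_iff)
  then show "\<exists>m. \<forall>i. g \<preceq> \<delta> [^] (i::int) \<longrightarrow> m \<le> i" by blast
qed

lemma infimum_preceq: "g \<in> carrier G \<Longrightarrow> \<delta> [^] infimum g \<preceq> g"
  and infimum_greatest: "g \<in> carrier G \<Longrightarrow> \<delta> [^] k \<preceq> g \<Longrightarrow> k \<le> infimum g"
proof -
  assume g: "g \<in> carrier G"
  obtain n :: int where n: "\<delta> [^] n \<preceq> g" using delta_pow_preceq[OF g] by blast
  obtain m :: int where m: "\<forall>i. \<delta> [^] i \<preceq> g \<longrightarrow> i \<le> m"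
    using delta_pow_preceq_bounded(1)[OF g] ..
  note * = int_Greatest[of "\<lambda>i. \<delta> [^] i \<preceq> g", OF n m[rule_format]]
  show "\<delta> [^] infimum g \<preceq> g" unfolding infimum_def by (rule *(1))
  show "\<delta> [^] k \<preceq> g \<Longrightarrow> k \<le> infimum g" unfolding infimum_def by (rule *(2))
qed

lemma preceq_supremum: "g \<in> carrier G \<Longrightarrow> g \<preceq> \<delta> [^] supremum g"
  and supremum_least: "g \<in> carrier G \<Longrightarrow> g \<preceq> \<delta> [^] k \<Longrightarrow> supremum g \<le> k"
proof -
  assume g: "g \<in> carrier G"
  obtain n :: int where n: "g \<preceq> \<delta> [^] n" using preceq_delta_pow[OF g] by blast
  obtain m :: int where m: "\<forall>i. g \<preceq> \<delta> [^] i \<longrightarrow> m \<le> i"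
    using delta_pow_preceq_bounded(2)[OF g] ..
  note * = int_Least[of "\<lambda>i. g \<preceq> \<delta> [^] i", OF n m[rule_format]]
  show "g \<preceq> \<delta> [^] supremum g" unfolding supremum_def by (rule *(1))
  show "g \<preceq> \<delta> [^] k \<Longrightarrow> supremum g \<le> k" unfolding supremum_def by (rule *(2))
qed

lemma len_nonneg: "g \<in> carrier G \<Longrightarrow> 0 \<le> len g"
  using preceq_trans[OF infimum_preceq preceq_supremum] delta_pow_preceq_iff
  by (simp add: len_def)

text \<open>\<open>greedy_exists\<close> and \<open>greedy_unique\<close> at length
  \<open>len x\<close> justify the \<open>THE\<close> in \<open>normal_form\<close>, and
  \<open>greedy_hd\<close> computes the head. Nonzero length makes the list nonempty, so that
  \<open>hd\<close> is meaningful.\<close>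

lemma hd_normal_form:
  assumes x: "x \<in> carrier G" and len: "len x \<noteq> 0"
  shows "hd (normal_form x) = lgcd (\<delta> [^] (- infimum x) \<otimes> x) \<delta>"
proof -
  define P where "P = \<delta> [^] (- infimum x) \<otimes> x"
  have PM: "P \<in> M" using infimum_preceq[OF x] by (simp add: P_def preceq_def int_pow_neg)
  have xP: "x = \<delta> [^] infimum x \<otimes> P" using x by (simp add: P_def int_pow_neg)
  have "P \<preceq> \<delta> [^] (- infimum x) \<otimes> \<delta> [^] supremum x"
    unfolding P_def using x preceq_supremum by simp
  also have "\<dots> = \<delta> [^] int (nat (len x))"
    using len_nonneg[OF x] by (simp add: len_def int_pow_mult [symmetric])
  finally have "P \<preceq> \<delta> [^] int (nat (len x))" .
  from greedy_exists[OF PM this]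
  obtain As where As: "set As \<subseteq> simples" "length As = nat (len x)" "mprod G As = P" "greedy As"
    by (elim exE conjE) (rule that)
  have nf: "is_normal_form x Bs \<longleftrightarrow>
      set Bs \<subseteq> simples \<and> length Bs = nat (len x) \<and> mprod G Bs = P \<and> greedy Bs" for Bs
  proof -
    have "x = \<delta> [^] infimum x \<otimes> mprod G Bs \<longleftrightarrow> mprod G Bs = P" if "set Bs \<subseteq> simples"
    proof -
      have "mprod G Bs \<in> carrier G"
        using mprod_closed[OF subset_trans[OF that simples_subset_M]] by simp
      then have "\<delta> [^] infimum x \<otimes> P = \<delta> [^] infimum x \<otimes> mprod G Bs \<longleftrightarrow> mprod G Bs = P"
        using PM by (simp add: eq_commute[of P])
      then show ?thesis unfolding xP [symmetric] .
    qed
    moreover have "int (length Bs) = len x \<longleftrightarrow> length Bs = nat (len x)"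
      using len_nonneg[OF x] by linarith
    ultimately show ?thesis unfolding is_normal_form_def greedy_def by blast
  qed
  have "normal_form x = As"
    unfolding normal_form_def nf
  proof (rule the_equality)
    fix Bs assume "set Bs \<subseteq> simples \<and> length Bs = nat (len x) \<and> mprod G Bs = P \<and> greedy Bs"
    then show "Bs = As" using greedy_unique[of Bs As] As by metis
  qed (use As in simp)
  moreover have "As \<noteq> []" using As(2) len len_nonneg[OF x] by force
  ultimately show ?thesis using greedy_hd[of As] As P_def by metis
qed

text \<open>\<open>tau_pow (- infimum x)\<close> commutes with gcds, fixes \<delta> and moves the
  power of \<delta> from the left of x to its right, which turns the gcd for the head into the
  initial factor. For length 0, x is a power of \<delta> and the initial factor is 1.\<close>

lemma cycling_eq:
  assumes x: "x \<in> carrier G"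
  shows "cycling x = conj_by x (initial_factor x)"
proof (cases "len x = 0")
  case True
  then have "x \<preceq> \<delta> [^] infimum x" using preceq_supremum[OF x] by (simp add: len_def)
  then have "x = \<delta> [^] infimum x" using infimum_preceq x by (intro preceq_antisym) auto
  then have "x \<otimes> \<delta> [^] (- infimum x) = \<one>"
    by (metis int_pow_neg delta_in_carrier r_inv x)
  then have "initial_factor x = lgcd \<one> \<delta>" by (simp add: initial_factor_def)
  also have "\<dots> = \<one>" using delta_in_M by (intro lgcd_eqI) auto
  finally show ?thesis using True x by (simp add: cycling_def)
next
  case False
  have "tau_pow (- infimum x) (\<delta> [^] (- infimum x) \<otimes> x) = x \<otimes> \<delta> [^] (- infimum x)"
    using x by (simp add: tau_pow_def conj_by_def m_assoc)
  then have "tau_pow (- infimum x) (hd (normal_form x)) = initial_factor x"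
    using hd_normal_form[OF x False] x by (simp add: initial_factor_def tau_pow_lgcd)
  then show ?thesis using False by (simp add: cycling_def)
qed

section \<open>Invariance of the summit sets under cycling\<close>

lemma cycling_closed [simp]: "y \<in> carrier G \<Longrightarrow> cycling y \<in> carrier G"
  by (simp add: cycling_eq)

lemma funpow_cycling_closed [simp]: "y \<in> carrier G \<Longrightarrow> (cycling ^^ n) y \<in> carrier G"
  by (induction n) simp_all

text \<open>Write x = i R \<delta>^k with i the initial factor, k the infimum and R in
  \<open>M\<close>. Cycling gives R \<delta>^k i, and moving \<delta>^k to the front conjugates R
  within \<open>M\<close>.\<close>

lemma infimum_cycling:
  assumes x: "x \<in> carrier G"
  shows "infimum x \<le> infimum (cycling x)"
proof (rule infimum_greatest)
  let ?i = "initial_factor x"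
  have "\<one> \<otimes> \<delta> [^] infimum x \<preceq> (x \<otimes> \<delta> [^] (- infimum x)) \<otimes> \<delta> [^] infimum x"
    using infimum_preceq x by (simp add: m_assoc int_pow_neg)
  then have "\<one> \<preceq> x \<otimes> \<delta> [^] (- infimum x)"
    using x by (subst (asm) preceq_mult_delta_pow) auto
  moreover have "\<one> \<preceq> \<delta>" using delta_in_M by simp
  ultimately have "\<one> \<preceq> ?i"
    unfolding initial_factor_def using x by (intro lgcd_greatest) simp_all
  moreover have "?i \<preceq> x \<otimes> \<delta> [^] (- infimum x)"
    using x by (simp add: initial_factor_def lgcd_left)
  ultimately have M: "?i \<in> M" "inv ?i \<otimes> (x \<otimes> \<delta> [^] (- infimum x)) \<in> M" (is "?R \<in> M")
    using x by (simp_all add: preceq_def)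
  have "cycling x = ?R \<otimes> \<delta> [^] infimum x \<otimes> ?i"
    using x by (simp add: cycling_eq conj_by_def m_assoc int_pow_neg)
  also have "\<dots> = \<delta> [^] infimum x \<otimes> (tau_pow (infimum x) ?R \<otimes> ?i)"
    using M x by (simp add: mult_delta_pow m_assoc)
  finally show "\<delta> [^] infimum x \<preceq> cycling x"
    using M(1) tau_pow_M[OF M(2)] by (simp add: preceq_mult_right)
qed (use x in simp)

text \<open>For the initial factor i and m = sup x, the claim amounts to x i being below i
  \<delta>^m. As i is a gcd, two bounds suffice: x \<delta>^(m - inf x), which holds because nonzero
  length puts i below \<delta>^(m - inf x), and \<delta> \<delta>^m, which follows from i below
  \<delta> and x below \<delta>^m.\<close>

lemma supremum_cycling:
  assumes x: "x \<in> carrier G"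
  shows "supremum (cycling x) \<le> supremum x"
proof (cases "len x = 0")
  case True
  then show ?thesis by (simp add: cycling_def)
next
  case False
  let ?i = "initial_factor x" and ?m = "supremum x"
  have i: "?i \<preceq> \<delta>" "?i \<in> carrier G" using x by (simp_all add: initial_factor_def lgcd_right)
  have "1 \<le> ?m - infimum x" using False len_nonneg[OF x] by (simp add: len_def)
  then have "\<delta> [^] (1::int) \<preceq> \<delta> [^] (- infimum x + ?m)" by (subst delta_pow_preceq_iff) simp
  then have "\<delta> \<preceq> \<delta> [^] (- infimum x + ?m)" by simp
  then have "?i \<preceq> \<delta> [^] (- infimum x + ?m)"
    using preceq_trans[OF i(1)] i(2) by simp
  then have "x \<otimes> ?i \<preceq> x \<otimes> \<delta> [^] (- infimum x) \<otimes> \<delta> [^] ?m"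
    using i x int_pow_mult[of \<delta> "- infimum x" ?m] by (simp add: m_assoc)
  moreover have "x \<otimes> ?i \<preceq> \<delta> \<otimes> \<delta> [^] ?m"
  proof -
    have "x \<otimes> ?i \<preceq> x \<otimes> \<delta>" using i x by simp
    also have "x \<otimes> \<delta> \<preceq> \<delta> [^] ?m \<otimes> \<delta>"
      using preceq_mult_delta_pow[of x "\<delta> [^] ?m" 1] x preceq_supremum by simp
    also have "\<delta> [^] ?m \<otimes> \<delta> = \<delta> \<otimes> \<delta> [^] ?m"
      using int_pow_mult[of \<delta> ?m 1] int_pow_mult[of \<delta> 1 ?m] by (simp add: add.commute)
    finally show ?thesis using i x by simp
  qed
  ultimately have "x \<otimes> ?i \<preceq> ?i \<otimes> \<delta> [^] ?m"
    using i x unfolding initial_factor_def by (intro preceq_lgcd_mult_delta_pow) simp_all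
  then have "?i \<otimes> cycling x \<preceq> ?i \<otimes> \<delta> [^] ?m"
    using i x by (simp add: cycling_eq conj_by_def m_assoc)
  then show ?thesis using i x by (simp add: supremum_least)
qed

lemma super_summit_set_cycling:
  assumes "x \<in> carrier G" "y \<in> super_summit_set x"
  shows "(cycling ^^ n) y \<in> super_summit_set x"
proof (induction n)
  case (Suc n)
  let ?z = "(cycling ^^ n) y"
  have z: "?z \<in> carrier G" using super_summit_set_closed assms(1) Suc by blast
  have "cycling ?z \<in> conj_class x"
    using conj_class_conj_by assms(1) Suc z by (simp add: cycling_eq super_summit_set_def)
  then show ?case
    using super_summit_setI[OF Suc] infimum_cycling supremum_cycling z by simp
qed (use assms in simp)

lemma ultra_summit_set_subset: "y \<in> ultra_summit_set x \<Longrightarrow> y \<in> super_summit_set x"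
  by (simp add: ultra_summit_set_def)

lemma ultra_summit_set_closed: "x \<in> carrier G \<Longrightarrow> y \<in> ultra_summit_set x \<Longrightarrow> y \<in> carrier G"
  using super_summit_set_closed ultra_summit_set_subset by blast

lemma ultra_summit_set_cycling:
  assumes "x \<in> carrier G" "y \<in> ultra_summit_set x"
  shows "(cycling ^^ n) y \<in> ultra_summit_set x"
proof -
  obtain k where k: "k > 0" "(cycling ^^ k) y = y" using assms by (auto simp: ultra_summit_set_def)
  have "(cycling ^^ k) ((cycling ^^ n) y) = (cycling ^^ n) y"
    using k(2) funpow_swap[of k cycling n y] by simp
  then show ?thesis
    using k(1) assms super_summit_set_cycling by (auto simp: ultra_summit_set_def)
qed

subsection \<open>Transport\<close>

primrec cycling_conjugator :: "nat \<Rightarrow> 'a \<Rightarrow> 'a" where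
  "cycling_conjugator 0 y = \<one>"
| "cycling_conjugator (Suc n) y = initial_factor y \<otimes> cycling_conjugator n (cycling y)"

lemma cycling_conjugator_closed [simp]:
  "y \<in> carrier G \<Longrightarrow> cycling_conjugator n y \<in> carrier G"
  by (induction n arbitrary: y) simp_all

lemma conj_by_cycling_conjugator:
  "y \<in> carrier G \<Longrightarrow> conj_by y (cycling_conjugator n y) = (cycling ^^ n) y"
  by (induction n arbitrary: y)
    (simp_all add: conj_by_mult cycling_eq [symmetric] funpow_swap1)

lemma cycling_conjugator_add:
  "y \<in> carrier G \<Longrightarrow> cycling_conjugator (m + n) y =
    cycling_conjugator m y \<otimes> cycling_conjugator n ((cycling ^^ m) y)"
  by (induction m arbitrary: y) (simp_all add: m_assoc funpow_swap1)

lemma cycling_tau: "y \<in> carrier G \<Longrightarrow> cycling (tau_pow n y) = tau_pow n (cycling y)"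
  by (simp add: cycling_eq initial_factor_tau)
    (simp add: tau_pow_def conj_by_def inv_mult_group m_assoc)

lemma cycling_conjugator_tau:
  "y \<in> carrier G \<Longrightarrow> cycling_conjugator n (tau_pow k y) = tau_pow k (cycling_conjugator n y)"
  by (induction n arbitrary: y)
    (simp_all add: tau_pow_of_one tau_pow_mult initial_factor_tau cycling_tau)

text \<open>The fourth side of a commuting square whose other sides are s and the conjugators along
  n cyclings of y and of its conjugate by s. By \<open>transport_add\<close> it is an iterate of the
  one-step version.\<close>

definition transport :: "nat \<Rightarrow> 'a \<Rightarrow> 'a \<Rightarrow> 'a" where
  "transport n y s = inv (cycling_conjugator n y) \<otimes> s \<otimes> cycling_conjugator n (conj_by y s)"

lemma transport_closed [simp]:
  "y \<in> carrier G \<Longrightarrow> s \<in> carrier G \<Longrightarrow> transport n y s \<in> carrier G"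
  by (simp add: transport_def)

lemma conj_by_transport:
  assumes "y \<in> carrier G" "s \<in> carrier G"
  shows "conj_by ((cycling ^^ n) y) (transport n y s) = (cycling ^^ n) (conj_by y s)"
proof -
  let ?c = "cycling_conjugator n y" and ?d = "cycling_conjugator n (conj_by y s)"
  have "conj_by ((cycling ^^ n) y) (transport n y s) = conj_by y (?c \<otimes> transport n y s)"
    using assms by (simp add: conj_by_mult conj_by_cycling_conjugator)
  also have "?c \<otimes> transport n y s = s \<otimes> ?d" using assms by (simp add: transport_def m_assoc)
  also have "conj_by y (s \<otimes> ?d) = (cycling ^^ n) (conj_by y s)"
    using assms by (simp add: conj_by_mult conj_by_cycling_conjugator)
  finally show ?thesis .
qed

lemma transport_zero: "y \<in> carrier G \<Longrightarrow> s \<in> carrier G \<Longrightarrow> transport 0 y s = s"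
  by (simp add: transport_def)

lemma transport_add:
  assumes "y \<in> carrier G" "s \<in> carrier G"
  shows "transport (m + n) y s = transport n ((cycling ^^ m) y) (transport m y s)"
  unfolding transport_def[of "m + n"] transport_def[of n] conj_by_transport[OF assms]
  using assms by (simp add: cycling_conjugator_add transport_def inv_mult_group m_assoc)

lemma transport_one [simp]: "y \<in> carrier G \<Longrightarrow> transport n y \<one> = \<one>"
  by (simp add: transport_def)

text \<open>Cycling commutes with \<tau>, so the conjugator at the conjugate of y by \<delta> is the
  \<tau>-image of the one at y; moving \<delta> past it cancels the two.\<close>

lemma transport_delta [simp]:
  assumes "y \<in> carrier G"
  shows "transport n y \<delta> = \<delta>"
proof -
  have "conj_by y \<delta> = tau_pow 1 y" by (simp add: tau_pow_def)
  then have "transport n y \<delta> = inv (cycling_conjugator n y) \<otimes> \<delta> \<otimes> tau_pow 1 (cycling_conjugator n y)"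
    using assms by (simp add: transport_def cycling_conjugator_tau)
  then show ?thesis using assms by (simp add: tau_pow_def conj_by_def m_assoc)
qed

text \<open>Equal targets have the same conjugator on the right, and it cancels. For simple elements
  inside the ultra summit set, \<open>transport_inj\<close> removes the condition on the
  targets.\<close>

lemma transport_cancel:
  assumes "y \<in> carrier G" "u \<in> carrier G" "v \<in> carrier G"
    "conj_by y u = conj_by y v" "transport n y u = transport n y v"
  shows "u = v"
  using assms by (simp add: transport_def)

text \<open>After cancelling the initial factor of y, compare s \<iota>(y^s) for s = u and s = v. By
  left invariance it is the gcd of y s \<delta>^(-k) and s \<delta>, both monotone in s; equal
  infima ensure the same exponent k for u and v.\<close>

lemma transport_1_mono:
  assumes "y \<in> carrier G" "u \<in> carrier G" "v \<in> carrier G" "u \<preceq> v"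
    and inf: "infimum (conj_by y u) = infimum (conj_by y v)"
  shows "transport 1 y u \<preceq> transport 1 y v"
proof -
  define k where "k = infimum (conj_by y v)"
  let ?Q = "\<lambda>s. initial_factor (conj_by y s)"
  have *: "s \<otimes> ?Q s \<preceq> y \<otimes> s \<otimes> \<delta> [^] (- k)" "s \<otimes> ?Q s \<preceq> s \<otimes> \<delta>"
    if "s \<in> carrier G" "infimum (conj_by y s) = k" for s
  proof -
    have "s \<otimes> ?Q s \<preceq> s \<otimes> (conj_by y s \<otimes> \<delta> [^] (- k))"
      using that assms by (simp add: initial_factor_def lgcd_left)
    then show "s \<otimes> ?Q s \<preceq> y \<otimes> s \<otimes> \<delta> [^] (- k)"
      using that assms by (simp add: conj_by_def m_assoc)
    show "s \<otimes> ?Q s \<preceq> s \<otimes> \<delta>"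
      using that assms by (simp add: initial_factor_def lgcd_right)
  qed
  have "u \<otimes> ?Q u \<preceq> y \<otimes> u \<otimes> \<delta> [^] (- k)" using * assms by (simp add: k_def)
  also have "y \<otimes> u \<otimes> \<delta> [^] (- k) \<preceq> y \<otimes> v \<otimes> \<delta> [^] (- k)"
    using assms by simp
  also have "\<dots> = v \<otimes> (conj_by y v \<otimes> \<delta> [^] (- k))"
    using assms by (simp add: conj_by_def m_assoc)
  finally have 1: "u \<otimes> ?Q u \<preceq> v \<otimes> (conj_by y v \<otimes> \<delta> [^] (- k))" using assms by simp
  have "u \<otimes> ?Q u \<preceq> u \<otimes> \<delta>" using * assms by (simp add: k_def)
  also have "u \<otimes> \<delta> \<preceq> v \<otimes> \<delta>" using preceq_mult_delta_pow[of u v 1] assms by simp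
  finally have 2: "u \<otimes> ?Q u \<preceq> v \<otimes> \<delta>" using assms by simp
  let ?w = "inv v \<otimes> (u \<otimes> ?Q u)"
  have "?w \<preceq> conj_by y v \<otimes> \<delta> [^] (- k)" "?w \<preceq> \<delta>"
    using 1 2 mult_preceq_iff[of ?w "conj_by y v \<otimes> \<delta> [^] (- k)" v]
      mult_preceq_iff[of ?w \<delta> v] assms(1-3) by simp_all
  then have "?w \<preceq> ?Q v"
    unfolding initial_factor_def[of "conj_by y v"] k_def using assms(1-3) by (intro lgcd_greatest) simp_all
  then have "u \<otimes> ?Q u \<preceq> v \<otimes> ?Q v"
    using mult_preceq_iff[of ?w "?Q v" v] assms(1-3) by simp
  then show ?thesis using assms(1-3) by (simp add: transport_def m_assoc)
qed

text \<open>Each single step needs equal infima. They persist because cycling stays in the super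
  summit set, on which the infimum is constant.\<close>

lemma transport_mono:
  assumes x: "x \<in> carrier G" and y: "y \<in> super_summit_set x"
    and u: "u \<in> carrier G" "conj_by y u \<in> super_summit_set x"
    and v: "v \<in> carrier G" "conj_by y v \<in> super_summit_set x" and "u \<preceq> v"
  shows "transport n y u \<preceq> transport n y v"
proof (induction n)
  case 0
  then show ?case using assms super_summit_set_closed by (simp add: transport_zero)
next
  case (Suc n)
  have yc: "y \<in> carrier G" using super_summit_set_closed x y by blast
  have "infimum ((cycling ^^ n) (conj_by y u)) = infimum ((cycling ^^ n) (conj_by y v))"
    using super_summit_set_infimum super_summit_set_cycling x u v by blast
  then have "transport 1 ((cycling ^^ n) y) (transport n y u) \<preceq>
      transport 1 ((cycling ^^ n) y) (transport n y v)"
    using Suc yc u v by (intro transport_1_mono) (simp_all add: conj_by_transport)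
  then show ?case using transport_add[of y _ n 1] yc u v by simp
qed

lemma transport_simples:
  assumes x: "x \<in> carrier G" and y: "y \<in> super_summit_set x"
    and u: "u \<in> simples" "conj_by y u \<in> super_summit_set x"
  shows "transport n y u \<in> simples"
proof -
  have yc: "y \<in> carrier G" using super_summit_set_closed x y by blast
  have uc: "u \<in> carrier G" "\<one> \<preceq> u" "u \<preceq> \<delta>" using u simplesD by simp_all
  have "transport n y \<one> \<preceq> transport n y u"
    using assms uc yc by (intro transport_mono[OF x y]) simp_all
  moreover have "transport n y u \<preceq> transport n y \<delta>"
    using assms uc super_summit_set_tau by (intro transport_mono[OF x y]) simp_all
  ultimately show ?thesis using yc uc by (simp add: simples_def)
qed

section \<open>Transport within the ultra summit set\<close>

lemma transport_return:
  assumes x: "x \<in> carrier G" and y: "y \<in> ultra_summit_set x"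
    and s: "s \<in> simples" "conj_by y s \<in> ultra_summit_set x"
  obtains m where "m > 0" "(cycling ^^ m) y = y"
    "(cycling ^^ m) (conj_by y s) = conj_by y s" "transport m y s = s"
proof -
  have c: "y \<in> carrier G" "s \<in> carrier G" using ultra_summit_set_closed x y s simplesD by auto
  obtain k where k: "k > 0" "(cycling ^^ k) y = y" using y by (auto simp: ultra_summit_set_def)
  obtain l where l: "l > 0" "(cycling ^^ l) (conj_by y s) = conj_by y s"
    using s by (auto simp: ultra_summit_set_def)
  \<comment> \<open>A common period of both trajectories, so that every \<open>?f i\<close>
    conjugates \<open>y\<close> to the same element.\<close>
  define p where "p = k * l"
  have period: "(cycling ^^ (i * p)) y = y"
    "(cycling ^^ (i * p)) (conj_by y s) = conj_by y s" for i
    using funpow_mult_fixpoint[OF k(2), of "i * l"] funpow_mult_fixpoint[OF l(2), of "i * k"]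
    by (simp_all add: p_def mult_ac)
  let ?f = "\<lambda>i. transport (i * p) y s"
  have "?f i \<in> simples" for i
    using x y s ultra_summit_set_subset by (intro transport_simples) auto
  then have "range ?f \<subseteq> simples" by auto
  then have "finite (range ?f)" using finite_simples by (rule finite_subset)
  \<comment> \<open>Pigeonhole on the simple elements gives i < j with equal values; cancelling the
    last i p transports leaves \<open>s\<close> fixed after (j - i) p of them.\<close>
  then have "\<not> inj ?f" using finite_imageD[of ?f UNIV] infinite_UNIV_nat by auto
  then obtain i j where ij: "i < j" "?f i = ?f j"
    unfolding inj_def by (metis linorder_neqE_nat)
  define d where "d = (j - i) * p"
  have d: "(cycling ^^ d) y = y" "(cycling ^^ d) (conj_by y s) = conj_by y s"
    unfolding d_def by (rule period)+
  have dp: "d + i * p = j * p"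
    unfolding d_def add_mult_distrib [symmetric] using ij(1) by simp
  have "transport (i * p) y (transport d y s) = ?f j"
    using transport_add[OF c, of d "i * p"] by (simp add: d(1) dp)
  moreover have "conj_by y (transport d y s) = conj_by y s"
    using conj_by_transport[OF c, of d] by (simp add: d)
  ultimately have "transport d y s = s"
    using transport_cancel[of y "transport d y s" s "i * p"] c ij by simp
  moreover have "d > 0" using k(1) l(1) ij(1) by (simp add: d_def p_def)
  ultimately show ?thesis using that d by blast
qed

lemma transport_return_mult:
  assumes "y \<in> carrier G" "s \<in> carrier G" "(cycling ^^ m) y = y" "transport m y s = s"
  shows "transport (q * m) y s = s"
  using assms by (induction q) (simp_all add: transport_zero transport_add)

text \<open>u and v return after k and l transports, so n k l transports fix both. They begin with
  the n transports on which u and v agree, as k and l are positive.\<close>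

lemma transport_inj:
  assumes x: "x \<in> carrier G" and y: "y \<in> ultra_summit_set x"
    and u: "u \<in> simples" "conj_by y u \<in> ultra_summit_set x"
    and v: "v \<in> simples" "conj_by y v \<in> ultra_summit_set x"
    and eq: "transport n y u = transport n y v"
  shows "u = v"
proof -
  have c: "y \<in> carrier G" "u \<in> carrier G" "v \<in> carrier G"
    using ultra_summit_set_closed x y u v simplesD by auto
  obtain k where k: "k > 0" "(cycling ^^ k) y = y" "transport k y u = u"
    using transport_return[OF x y u] by metis
  obtain l where l: "l > 0" "(cycling ^^ l) y = y" "transport l y v = v"
    using transport_return[OF x y v] by metis
  define r where "r = n * k * l - n"
  have nr: "n * k * l = n + r" using k(1) l(1) by (simp add: r_def)
  have "u = transport (n * k * l) y u"
    using transport_return_mult[OF c(1,2) k(2,3), of "n * l"] by (simp add: mult_ac)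
  also have "\<dots> = transport (n * k * l) y v"
    using c eq by (simp add: nr transport_add)
  also have "\<dots> = v" using transport_return_mult[OF c(1,3) l(2,3), of "n * k"] by simp
  finally show ?thesis .
qed

text \<open>Since 1 is simple and is transported to 1, injectivity keeps every other element away
  from 1.\<close>

lemma transport_ultra_simples:
  assumes x: "x \<in> carrier G" and y: "y \<in> ultra_summit_set x" and s: "s \<in> ultra_simples x y"
  shows "transport n y s \<in> ultra_simples x ((cycling ^^ n) y)"
proof -
  have s': "s \<in> simples" "s \<noteq> \<one>" "conj_by y s \<in> ultra_summit_set x" "s \<in> carrier G"
    using s simplesD by (auto simp: ultra_simples_def)
  have yc: "y \<in> carrier G" using ultra_summit_set_closed x y by blast
  have "\<one> \<in> simples" using delta_in_M by (simp add: simples_def)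
  then have "transport n y s \<noteq> \<one>"
    using transport_inj[OF x y s'(1,3), of \<one> n] s'(2) y yc by auto
  moreover have "transport n y s \<in> simples"
    using x y s' ultra_summit_set_subset by (intro transport_simples) auto
  moreover have "conj_by ((cycling ^^ n) y) (transport n y s) \<in> ultra_summit_set x"
    using conj_by_transport yc s' ultra_summit_set_cycling x by simp
  ultimately show ?thesis by (simp add: ultra_simples_def)
qed

text \<open>
  If \<open>y = (cycling ^^ l) z\<close>, the witness is the transport \<open>t\<close> of \<open>s\<close> along the \<open>l\<close> cyclings from \<open>z\<close> to \<open>y\<close>:
  some further transport takes \<open>y\<close> back to \<open>z\<close> and \<open>t\<close> back to \<open>s\<close>, so an element of \<open>D\<^sub>y\<close> below \<open>t\<close>
  yields an element of \<open>D\<^sub>z\<close> below \<open>s\<close>.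
\<close>

lemma minimal_simple_transport:
  assumes x: "x \<in> carrier G" and y: "y \<in> ultra_summit_set x" and z: "z \<in> trajectory y"
    and s: "s \<in> minimal_simples x z"
  shows "\<exists>t\<in>minimal_simples x y. conj_by z s \<in> trajectory (conj_by y t)"
proof -
  obtain k where zk: "z = (cycling ^^ k) y" using z by (auto simp: trajectory_def)
  obtain p where p: "p > 0" "(cycling ^^ p) y = y" using y by (auto simp: ultra_summit_set_def)
  \<comment> \<open>These cyclings complete k periods of \<open>y\<close> and so lead from
    \<open>z\<close> back to \<open>y\<close>; the subtraction is exact because p is
    positive.\<close>
  define l where "l = k * p - k"
  have "k \<le> k * p" using p(1) by simp
  then have "(cycling ^^ l) z = (cycling ^^ (k * p)) y"
    unfolding zk l_def by (metis funpow_add comp_apply le_add_diff_inverse2)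
  then have l: "(cycling ^^ l) z = y" using funpow_mult_fixpoint[OF p(2), of k] by simp
  have zU: "z \<in> ultra_summit_set x" using ultra_summit_set_cycling x y zk by simp
  have sD: "s \<in> ultra_simples x z" using s by (simp add: minimal_simples_def)
  then have s': "s \<in> simples" "conj_by z s \<in> ultra_summit_set x" "s \<in> carrier G"
    using simplesD by (auto simp: ultra_simples_def)
  have c: "y \<in> carrier G" "z \<in> carrier G" using ultra_summit_set_closed x y zU by auto
  obtain m where m: "m > 0" "(cycling ^^ m) z = z" "(cycling ^^ m) (conj_by z s) = conj_by z s"
    "transport m z s = s"
    using transport_return[OF x zU s'(1,2)] by metis
  \<comment> \<open>After the l steps from \<open>z\<close> to \<open>y\<close>, another r steps
    complete l returns of both \<open>z\<close> and \<open>s\<close>; they therefore take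
    \<open>y\<close> to \<open>z\<close> and \<open>t\<close> to \<open>s\<close>.\<close>
  define r where "r = l * m - l"
  have lr: "l * m = l + r" using m(1) by (simp add: r_def)
  define t where "t = transport l z s"
  have tD: "t \<in> ultra_simples x y"
    using transport_ultra_simples[OF x zU sD, of l] by (simp add: t_def l)
  have tU: "conj_by y t \<in> ultra_summit_set x" "t \<in> carrier G" "t \<in> simples"
    using tD simplesD by (auto simp: ultra_simples_def)
  have rz: "(cycling ^^ r) y = z"
    using funpow_mult_fixpoint[OF m(2), of l] l by (simp add: lr add.commute[of l] funpow_add)
  have rt: "transport r y t = s"
    using transport_return_mult[OF c(2) s'(3) m(2,4), of l] c s'(3)
    by (simp add: lr transport_add l t_def)
  have "v = t" if v: "v \<in> ultra_simples x y" "v \<preceq> t" for v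
  proof -
    have v': "v \<in> simples" "conj_by y v \<in> ultra_summit_set x" "v \<in> carrier G"
      using v simplesD by (auto simp: ultra_simples_def)
    have "transport r y v \<in> ultra_simples x z"
      using transport_ultra_simples[OF x y v(1), of r] by (simp add: rz)
    moreover have "transport r y v \<preceq> s"
      using transport_mono[OF x, of y v t r] ultra_summit_set_subset y v v' tU rt by blast
    ultimately have "transport r y v = transport r y t"
      using s rt by (simp add: minimal_simples_def)
    then show ?thesis using transport_inj[OF x y v'(1,2) tU(3,1)] by blast
  qed
  then have "t \<in> minimal_simples x y" using tD by (simp add: minimal_simples_def)
  moreover have "conj_by z s = (cycling ^^ r) (conj_by y t)"
    using conj_by_transport[OF c(1) tU(2), of r] by (simp add: rz rt)
  ultimately show ?thesis unfolding trajectory_def by blast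
qed

end

theorem theorem1p21:
  fixes G :: "('a, 'b) monoid_scheme" and M :: "'a set" and \<delta> x y z s :: 'a
  assumes "garside_group G M \<delta>"
    and "x \<in> carrier G"
    and "y \<in> garside_group.ultra_summit_set G M \<delta> x"
    and "z \<in> garside_group.trajectory G M \<delta> y"
    and "s \<in> garside_group.minimal_simples G M \<delta> x z"
  shows "\<exists>t \<in> garside_group.minimal_simples G M \<delta> x y.
           garside_group.conj_by G z s \<in>
             garside_group.trajectory G M \<delta> (garside_group.conj_by G y t)"
proof -
  interpret garside_group G M \<delta> by fact
  have s: "s \<in> simples" "s \<noteq> \<one>\<^bsub>G\<^esub>"
    using assms(5) by (auto simp: minimal_simples_def ultra_simples_def)
  \<comment> \<open>With \<delta> = 1 the only simple element would be 1, so the mere existence of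
    \<open>s\<close> excludes the degenerate group.\<close>
  have "\<delta> \<noteq> \<one>\<^bsub>G\<^esub>"
  proof
    assume "\<delta> = \<one>\<^bsub>G\<^esub>"
    then show False using s simplesD[of s] preceq_antisym[of s "\<one>\<^bsub>G\<^esub>"] by simp
  qed
  then interpret nontrivial_garside_group G M \<delta> by unfold_locales
  show ?thesis using minimal_simple_transport assms(2-5) .
qed

end
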